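(* Let $w\in S_n$. Every greedy chain of $[\mathrm{id},w]$ is a dominant chain of $D^w$, and \[\mathrm{supp}(D^w)=\mathrm{supp}(\mathrm{GW}(w)),\qquad \mathrm{GW}(w)=\prod_{(a,b)\in\mathrm{Inv}(w)}(x_a+x_{a+1}+\dots+x_{b-1}).\] Consequently, for all $w\in S_n$, the dual Schubert polynomial $D^w$ has the single chain Newton polytope (SCNP) property.
   Context: $S_n$ is the symmetric group on $[n]$; $\mathrm{Inv}(w)$ is the set of pairs $(a,b)$, $a<b$, with $w(a)>w(b)$, and $\ell(w)=|\mathrm{Inv}(w)|$. For $a<b$, $wt_{ab}$ swaps entries in positions $a,b$. Bruhat covers: $u\lessdot v$ iff $v=ut_{ab}$ ($a<b$) and $\ell(v)=\ell(u)+1$; $[u,w]=\{v:u\le v\le w\}$. Edge weight $m(u\lessdot ut_{ab})=x_a+\dots+x_{b-1}$; a saturated chain $C=(u_0\lessdot\cdots\lessdot u_\ell)$ has weight $m_C=\prod_i m(u_{i-1}\lessdot u_i)$. The dual Schubert polynomial is $D^w=\frac{1}{\ell(w)!}\sum_C m_C$ over saturated chains $C$ from $\mathrm{id}$ to $w$. The support of a polynomial is its set of exponent vectors with nonzero coefficient. A saturated chain $C$ in $[\mathrm{id},w]$ is a dominant chain of $D^w$ if $\mathrm{supp}(m_C)=\mathrm{supp}(D^w)$; $D^w$ has SCNP if a dominant chain exists. A saturated chain $u=w_0\lessdot\cdots\lessdot w_\ell=w$ is greedy if for every $i$, writing $w_i=w_{i-1}t_{ab}$ with $a<b$, there is no $w'_{i-1}\in[u,w]$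 with $w'_{i-1}\lessdot w_i$ and either $w_i=w'_{i-1}t_{ab'}$ with $b'>b$ or $w_i=w'_{i-1}t_{a'b}$ with $a'<a$. *)

theory Defs
  imports Complex_Main "HOL-Combinatorics.Permutations" "HOL-Library.Poly_Mapping"
begin

text \<open>
  The symmetric group \<open>S\<^sub>n\<close> consists of the functions \<open>w :: nat \<Rightarrow> nat\<close> with
  \<open>w permutes {1..n}\<close>; the one-line notation of \<open>w\<close> is \<open>w 1, \<dots>, w n\<close>.
\<close>

definition Inv :: "nat \<Rightarrow> (nat \<Rightarrow> nat) \<Rightarrow> (nat \<times> nat) set" where
  "Inv n w = {(a, b). 1 \<le> a \<and> a < b \<and> b \<le> n \<and> w a > w b}"

definition len :: "nat \<Rightarrow> (nat \<Rightarrow> nat) \<Rightarrow> nat" where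
  "len n w = card (Inv n w)"

text \<open>\<open>w \<circ> transpose a b\<close> is \<open>w\<close> with the entries in positions \<open>a\<close> and \<open>b\<close> swapped.\<close>

definition bruhat_cover :: "nat \<Rightarrow> (nat \<Rightarrow> nat) \<Rightarrow> (nat \<Rightarrow> nat) \<Rightarrow> bool" where
  "bruhat_cover n u v \<longleftrightarrow>
     u permutes {1..n} \<and> v permutes {1..n} \<and>
     (\<exists>a b. 1 \<le> a \<and> a < b \<and> b \<le> n \<and> v = u \<circ> transpose a b) \<and> len n v = len n u + 1"

definition bruhat_le :: "nat \<Rightarrow> (nat \<Rightarrow> nat) \<Rightarrow> (nat \<Rightarrow> nat) \<Rightarrow> bool" where
  "bruhat_le n = (bruhat_cover n)\<^sup>*\<^sup>*"

definition bruhat_interval :: "nat \<Rightarrow> (nat \<Rightarrow> nat) \<Rightarrow> (nat \<Rightarrow> nat) \<Rightarrow> (nat \<Rightarrow> nat) set" where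
  "bruhat_interval n u w = {v. v permutes {1..n} \<and> bruhat_le n u v \<and> bruhat_le n v w}"

text \<open>
  Polynomials over the rationals in the variables \<open>x\<^sub>i\<close>, \<open>i :: nat\<close>: finitely supported
  maps from exponent vectors to coefficients, with convolution as product. The support of
  a polynomial \<open>p\<close> is \<open>keys p\<close>.
\<close>

type_synonym polynomial = "(nat \<Rightarrow>\<^sub>0 nat) \<Rightarrow>\<^sub>0 rat"

definition X :: "nat \<Rightarrow> polynomial" where
  "X i = Poly_Mapping.single (Poly_Mapping.single i 1) 1"

definition Const :: "rat \<Rightarrow> polynomial" where
  "Const c = Poly_Mapping.single 0 c"

abbreviation supp :: "polynomial \<Rightarrow> (nat \<Rightarrow>\<^sub>0 nat) set" where
  "supp p \<equiv> Poly_Mapping.keys p"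

text \<open>
  The pair \<open>(a, b)\<close> is determined by the endpoints of the edge; see \<open>edge_weight_transpose\<close>.
\<close>

definition edge_weight :: "(nat \<Rightarrow> nat) \<Rightarrow> (nat \<Rightarrow> nat) \<Rightarrow> polynomial" where
  "edge_weight u v =
     (let (a, b) = (THE (a, b). a < b \<and> v = u \<circ> transpose a b) in \<Sum>i\<in>{a..<b}. X i)"

lemma transpose_eq_imp:
  fixes a b c d :: nat
  assumes "a < b" "c < d" "transpose a b = transpose c d"
  shows "a = c \<and> b = d"
proof -
  have "{x. transpose a b x \<noteq> x} = {a, b}" "{x. transpose c d x \<noteq> x} = {c, d}"
    using assms(1,2) by (auto simp: transpose_def)
  with assms show ?thesis by (auto simp: doubleton_eq_iff)
qed

lemma edge_weight_transpose:
  assumes "inj u" "a < b"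
  shows "edge_weight u (u \<circ> transpose a b) = (\<Sum>i\<in>{a..<b}. X i)"
proof -
  have "(THE (c, d). c < d \<and> u \<circ> transpose a b = u \<circ> transpose c d) = (a, b)"
  proof (rule the_equality, goal_cases)
    case 1
    show ?case using assms by simp
  next
    case (2 p)
    obtain c d where p: "p = (c, d)" by (cases p)
    with 2 have "c < d" and "u \<circ> transpose a b = u \<circ> transpose c d" by auto
    hence "transpose a b = transpose c d"
      using assms(1) by (auto simp: fun_eq_iff inj_eq)
    from transpose_eq_imp[OF assms(2) \<open>c < d\<close> this] show ?case by (simp add: p)
  qed
  thus ?thesis by (simp add: edge_weight_def)
qed

text \<open>A chain \<open>u\<^sub>0, \<dots>, u\<^sub>l\<close> is the list of its elements.\<close>

definition saturated_chain ::
  "nat \<Rightarrow> (nat \<Rightarrow> nat) \<Rightarrow> (nat \<Rightarrow> nat) \<Rightarrow> (nat \<Rightarrow> nat) list \<Rightarrow> bool" where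
  "saturated_chain n u w C \<longleftrightarrow>
     C \<noteq> [] \<and> hd C = u \<and> last C = w \<and> (\<forall>v\<in>set C. v permutes {1..n}) \<and>
     (\<forall>i. Suc i < length C \<longrightarrow> bruhat_cover n (C ! i) (C ! Suc i))"

definition chain_weight :: "(nat \<Rightarrow> nat) list \<Rightarrow> polynomial" where
  "chain_weight C = (\<Prod>i<length C - 1. edge_weight (C ! i) (C ! Suc i))"

lemma saturated_chain_len:
  assumes "saturated_chain n u w C" "i < length C"
  shows "len n (C ! i) = len n u + i"
  using assms(2)
proof (induction i)
  case 0
  thus ?case using assms(1) by (simp add: saturated_chain_def hd_conv_nth)
next
  case (Suc i)
  hence "bruhat_cover n (C ! i) (C ! Suc i)"
    using assms(1) by (simp add: saturated_chain_def)
  thus ?case using Suc by (simp add: bruhat_cover_def)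
qed

text \<open>Hence the sum in the definition of \<open>dual_schubert\<close> below ranges over a finite set.\<close>

lemma finite_saturated_chains: "finite {C. saturated_chain n u w C}"
proof (rule finite_subset)
  show "{C. saturated_chain n u w C} \<subseteq>
      {C. set C \<subseteq> {v. v permutes {1..n}} \<and> length C \<le> len n w + 1}"
  proof safe
    fix C assume C: "saturated_chain n u w C"
    hence "C \<noteq> []" "last C = w" by (auto simp: saturated_chain_def)
    hence "len n w = len n u + (length C - 1)"
      using saturated_chain_len[OF C, of "length C - 1"] by (simp add: last_conv_nth)
    thus "length C \<le> len n w + 1" by linarith
  qed (auto simp: saturated_chain_def)
  show "finite {C. set C \<subseteq> {v. v permutes {1..n}} \<and> length C \<le> len n w + 1}"
    by (rule finite_lists_length_le) (simp add: finite_permutations)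
qed

definition dual_schubert :: "nat \<Rightarrow> (nat \<Rightarrow> nat) \<Rightarrow> polynomial" where
  "dual_schubert n w =
     Const (1 / fact (len n w)) * (\<Sum>C | saturated_chain n id w C. chain_weight C)"

definition GW :: "nat \<Rightarrow> (nat \<Rightarrow> nat) \<Rightarrow> polynomial" where
  "GW n w = (\<Prod>(a, b)\<in>Inv n w. \<Sum>i\<in>{a..<b}. X i)"

definition dominant_chain :: "nat \<Rightarrow> (nat \<Rightarrow> nat) \<Rightarrow> (nat \<Rightarrow> nat) list \<Rightarrow> bool" where
  "dominant_chain n w C \<longleftrightarrow>
     saturated_chain n id w C \<and> supp (chain_weight C) = supp (dual_schubert n w)"

definition SCNP :: "nat \<Rightarrow> (nat \<Rightarrow> nat) \<Rightarrow> bool" where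
  "SCNP n w \<longleftrightarrow> (\<exists>C. dominant_chain n w C)"

definition greedy_chain ::
  "nat \<Rightarrow> (nat \<Rightarrow> nat) \<Rightarrow> (nat \<Rightarrow> nat) \<Rightarrow> (nat \<Rightarrow> nat) list \<Rightarrow> bool" where
  "greedy_chain n u w C \<longleftrightarrow>
     saturated_chain n u w C \<and>
     (\<forall>i a b. Suc i < length C \<longrightarrow> a < b \<longrightarrow> C ! Suc i = C ! i \<circ> transpose a b \<longrightarrow>
        \<not> (\<exists>v\<in>bruhat_interval n u w. bruhat_cover n v (C ! Suc i) \<and>
             ((\<exists>b'>b. C ! Suc i = v \<circ> transpose a b') \<or>
              (\<exists>a'<a. C ! Suc i = v \<circ> transpose a' b))))"

end

theory Submission
  imports Defs
begin

text \<open>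
  Let \<open>u\<close> be covered by \<open>v = u t\<^sub>a\<^sub>b\<close>. Fixing the inversions of \<open>u\<close> that are inversions of \<open>v\<close>
  and applying \<open>t\<^sub>a\<^sub>b\<close> to both positions of the others gives a bijection from \<open>Inv u\<close> onto
  \<open>Inv v - {(a, b)}\<close> that only enlarges the intervals \<open>[i, j)\<close>. Hence \<open>m(u, v) GW(u)\<close> is
  coefficientwise at most \<open>GW(v)\<close>, and along a chain \<open>m\<^sub>C\<close> is at most \<open>GW(w)\<close>. An inversion moved
  by the bijection produces an edge into \<open>v\<close> that violates greediness; so along a greedy chain both
  inequalities are equalities, and \<open>GW(w)\<close> itself occurs as a summand of \<open>\<ell>(w)! D\<^sup>w\<close>.
\<close>

section \<open>Polynomials with nonnegative coefficients\<close>

text \<open>The coefficientwise order between \<open>p\<close> and \<open>q\<close> is expressed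
  below as \<open>nonneg_coeffs (q - p)\<close>.\<close>

definition nonneg_coeffs :: "('a \<Rightarrow>\<^sub>0 'b::linordered_idom) \<Rightarrow> bool" where
  "nonneg_coeffs p \<longleftrightarrow> (\<forall>m. 0 \<le> Poly_Mapping.lookup p m)"

lemma nonneg_coeffs_0 [simp]: "nonneg_coeffs 0"
  by (simp add: nonneg_coeffs_def)

lemma nonneg_coeffs_single [simp]: "nonneg_coeffs (Poly_Mapping.single m c) \<longleftrightarrow> 0 \<le> c"
  by (auto simp: nonneg_coeffs_def lookup_single when_def)

lemma nonneg_coeffs_1 [simp]:
  "nonneg_coeffs (1 :: 'a::monoid_add \<Rightarrow>\<^sub>0 'b::linordered_idom)"
  by (simp flip: single_one)

lemma nonneg_coeffs_add: "nonneg_coeffs p \<Longrightarrow> nonneg_coeffs q \<Longrightarrow> nonneg_coeffs (p + q)"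
  by (simp add: nonneg_coeffs_def lookup_add)

lemma nonneg_coeffs_sum: "(\<And>i. i \<in> A \<Longrightarrow> nonneg_coeffs (f i)) \<Longrightarrow> nonneg_coeffs (sum f A)"
  by (induction A rule: infinite_finite_induct) (auto intro: nonneg_coeffs_add)

lemma nonneg_coeffs_mult:
  fixes p q :: "'a::monoid_add \<Rightarrow>\<^sub>0 'b::linordered_idom"
  assumes "nonneg_coeffs p" "nonneg_coeffs q"
  shows "nonneg_coeffs (p * q)"
proof -
  \<comment> \<open>Coefficients of a product are nested \<open>Sum_any\<close>. Such a sum runs
    over the nonzero terms and defaults to 0 if there are infinitely many, so nonnegative terms
    suffice.\<close>
  have "0 \<le> (\<Sum>x. f x)" if "\<And>x. 0 \<le> f x" for f :: "'a \<Rightarrow> 'b"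
    using that by (simp add: Sum_any.expand_set sum_nonneg)
  with assms show ?thesis
    by (simp add: nonneg_coeffs_def lookup_mult when_def)
qed

lemma nonneg_coeffs_prod:
  fixes f :: "'i \<Rightarrow> ('a::comm_monoid_add \<Rightarrow>\<^sub>0 'b::linordered_idom)"
  shows "(\<And>i. i \<in> A \<Longrightarrow> nonneg_coeffs (f i)) \<Longrightarrow> nonneg_coeffs (prod f A)"
  by (induction A rule: infinite_finite_induct) (auto intro: nonneg_coeffs_mult)

lemma nonneg_coeffs_diff_trans:
  "nonneg_coeffs (r - q) \<Longrightarrow> nonneg_coeffs (q - p) \<Longrightarrow> nonneg_coeffs (r - p)"
  using nonneg_coeffs_add[of "r - q" "q - p"] by simp

text \<open>Passing from \<open>p * q\<close> to \<open>p' * q'\<close> one factor at a time leaves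
  \<open>q\<close> and \<open>p'\<close> as multipliers of the two differences.\<close>

lemma nonneg_coeffs_diff_mult:
  fixes p q p' q' :: "'a::monoid_add \<Rightarrow>\<^sub>0 'b::linordered_idom"
  assumes "nonneg_coeffs p'" "nonneg_coeffs q" "nonneg_coeffs (p' - p)" "nonneg_coeffs (q' - q)"
  shows "nonneg_coeffs (p' * q' - p * q)"
proof -
  have "p' * q' - p * q = p' * (q' - q) + (p' - p) * q"
    by (simp add: algebra_simps)
  with assms show ?thesis by (simp add: nonneg_coeffs_add nonneg_coeffs_mult)
qed

lemma nonneg_coeffs_diff_prod:
  fixes f g :: "'i \<Rightarrow> ('a::comm_monoid_add \<Rightarrow>\<^sub>0 'b::linordered_idom)"
  assumes "\<And>i. i \<in> A \<Longrightarrow> nonneg_coeffs (f i)" "\<And>i. i \<in> A \<Longrightarrow> nonneg_coeffs (g i)"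
    and "\<And>i. i \<in> A \<Longrightarrow> nonneg_coeffs (g i - f i)"
  shows "nonneg_coeffs (prod g A - prod f A)"
  using assms
proof (induction A rule: infinite_finite_induct)
  case (insert i A)
  have "nonneg_coeffs (prod f A)" using insert.prems by (intro nonneg_coeffs_prod) auto
  with insert show ?case by (auto intro: nonneg_coeffs_diff_mult)
qed auto

text \<open>Nonnegativity excludes cancellation: a positive coefficient of \<open>p\<close> stays
  positive in the larger \<open>q\<close>.\<close>

lemma keys_mono_nonneg_coeffs:
  assumes "nonneg_coeffs p" "nonneg_coeffs (q - p)"
  shows "Poly_Mapping.keys p \<subseteq> Poly_Mapping.keys q"
proof
  fix m assume "m \<in> Poly_Mapping.keys p"
  with assms(1) have "0 < Poly_Mapping.lookup p m"
    by (auto simp: nonneg_coeffs_def in_keys_iff order_less_le)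
  with assms(2) have "0 < Poly_Mapping.lookup q m"
    by (auto simp: nonneg_coeffs_def lookup_minus intro: order.strict_trans2)
  thus "m \<in> Poly_Mapping.keys q" by (simp add: in_keys_iff)
qed

text \<open>Scaling never enlarges the support, and scaling back by \<open>1 / c\<close> gives the
  other inclusion. This disposes of the factor \<open>1 / fact (len n w)\<close>.\<close>

lemma keys_Const_mult:
  assumes "c \<noteq> 0"
  shows "supp (Const c * p) = supp p"
proof -
  have le: "supp (Const d * q) \<subseteq> supp q" for d q
    using keys_mult[of "Const d" q] by (auto simp: Const_def split: if_splits)
  have "Const (1 / c) * (Const c * p) = p"
    using assms by (simp add: Const_def mult_single flip: mult.assoc)
  with le[of c p] le[of "1 / c" "Const c * p"] show ?thesis by auto
qed

section \<open>Sums of variables and their products\<close>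

lemma nonneg_coeffs_sum_X: "nonneg_coeffs (\<Sum>i\<in>A. X i)"
  by (auto intro!: nonneg_coeffs_sum simp: X_def)

lemma nonneg_coeffs_sum_X_diff:
  assumes "finite B" "A \<subseteq> B"
  shows "nonneg_coeffs ((\<Sum>i\<in>B. X i) - (\<Sum>i\<in>A. X i))"
  using assms by (simp add: sum_diff[symmetric] nonneg_coeffs_sum_X)

lemma nonneg_coeffs_GW: "nonneg_coeffs (GW n w)"
  by (auto intro!: nonneg_coeffs_prod nonneg_coeffs_sum_X simp: GW_def)

section \<open>Inversions along a Bruhat cover\<close>

lemma finite_Inv [simp]: "finite (Inv n w)"
  by (rule finite_subset[of _ "{1..n} \<times> {1..n}"]) (auto simp: Inv_def)

lemma Inv_id [simp]: "Inv n id = {}"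
  by (auto simp: Inv_def)

definition move_inv ::
  "nat \<Rightarrow> (nat \<Rightarrow> nat) \<Rightarrow> nat \<Rightarrow> nat \<Rightarrow> nat \<times> nat \<Rightarrow> nat \<times> nat" where
  "move_inv n v a b p = (if p \<in> Inv n v then p else map_prod (transpose a b) (transpose a b) p)"

text \<open>The swap creates the inversion \<open>(a, b)\<close> but need not be a cover. Covers are
  singled out inside the locale, first by bijectivity of \<open>move_inv\<close>, then by a
  condition on values.\<close>

locale raising_swap =
  fixes n :: nat and u v :: "nat \<Rightarrow> nat" and a b :: nat
  assumes inj: "inj u" and ab: "1 \<le> a" "a < b" "b \<le> n" and up: "u a < u b"
    and v: "v = u \<circ> transpose a b"
begin

lemma v_at [simp]: "v a = u b" "v b = u a" "c \<noteq> a \<Longrightarrow> c \<noteq> b \<Longrightarrow> v c = u c"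
  by (simp_all add: v)

lemma v_transpose [simp]: "v (transpose a b c) = u c"
  by (simp add: v)

lemma u_transpose: "u (transpose a b c) = v c"
  by (simp add: v)

lemma top_mem_Inv: "(a, b) \<in> Inv n v"
  using ab up by (simp add: Inv_def)

text \<open>Only pairs meeting positions \<open>a\<close> or \<open>b\<close> are affected. The
  entry at \<open>a\<close> grows and the one at \<open>b\<close> shrinks, so an inversion can be
  lost only with \<open>b\<close> on its left or \<open>a\<close> on its right.\<close>

lemma moved_cases:
  assumes "(i, j) \<in> Inv n u" "(i, j) \<notin> Inv n v"
  obtains "i = b" "b < j" "j \<le> n" "u a < u j" "u j < u b"
    | "j = a" "1 \<le> i" "i < a" "u a < u i" "u i < u b"
proof -
  have *: "1 \<le> i" "i < j" "j \<le> n" "u j < u i" "v i \<le> v j"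
    using assms by (auto simp: Inv_def)
  have ne: "u i \<noteq> u j" "v i \<noteq> v j"
    using * inj by (auto simp: v inj_eq)
  show ?thesis
  proof (cases "i = b")
    case True
    with * ab ne that(1) show ?thesis by force
  next
    case i: False
    show ?thesis
    proof (cases "j = a")
      case True
      with * ab ne that(2) i show ?thesis by force
    next
      case False
      with i * ne up ab show ?thesis by (cases "i = a"; cases "j = b") auto
    qed
  qed
qed

text \<open>A lost inversion \<open>(b, j)\<close> becomes \<open>(a, j)\<close>, and
  \<open>(i, a)\<close> becomes \<open>(i, b)\<close>: one end moves outward. Neither image is
  \<open>(a, b)\<close>, as \<open>b < j\<close> and \<open>i < a\<close>; a fixed inversion is not
  \<open>(a, b)\<close> because \<open>u a < u b\<close>.\<close>

lemma move_inv_mem: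
  assumes "p \<in> Inv n u"
  shows "move_inv n v a b p \<in> Inv n v - {(a, b)}"
    and "{fst p..<snd p} \<subseteq> {fst (move_inv n v a b p)..<snd (move_inv n v a b p)}"
proof -
  obtain i j where p: "p = (i, j)" by fastforce
  have "(a, b) \<notin> Inv n u" using up by (simp add: Inv_def)
  hence "move_inv n v a b p \<in> Inv n v - {(a, b)} \<and>
      {fst p..<snd p} \<subseteq> {fst (move_inv n v a b p)..<snd (move_inv n v a b p)}"
  proof (cases "p \<in> Inv n v")
    case False
    with assms p have "(i, j) \<in> Inv n u" "(i, j) \<notin> Inv n v" by auto
    thus ?thesis
    proof (cases rule: moved_cases)
      case 1
      hence "move_inv n v a b p = (a, j)" using False ab by (simp add: p move_inv_def)
      with 1 ab show ?thesis by (auto simp: p Inv_def)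
    next
      case 2
      hence "move_inv n v a b p = (i, b)" using False ab by (simp add: p move_inv_def)
      with 2 ab show ?thesis by (auto simp: p Inv_def)
    qed
  qed (use assms in \<open>auto simp: move_inv_def\<close>)
  thus "move_inv n v a b p \<in> Inv n v - {(a, b)}"
    and "{fst p..<snd p} \<subseteq> {fst (move_inv n v a b p)..<snd (move_inv n v a b p)}" by auto
qed

lemma move_inv_image: "move_inv n v a b ` Inv n u \<subseteq> Inv n v - {(a, b)}"
  by (rule image_subsetI) (rule move_inv_mem(1))

text \<open>The swap turns values of \<open>u\<close> into values of \<open>v\<close>, so membership
  would make \<open>(i, j)\<close> an inversion of \<open>v\<close>. This keeps the images of moved
  and fixed pairs apart.\<close>

lemma transpose_not_mem_Inv:
  assumes "(i, j) \<in> Inv n u - Inv n v"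
  shows "(transpose a b i, transpose a b j) \<notin> Inv n u"
proof
  assume "(transpose a b i, transpose a b j) \<in> Inv n u"
  hence "v j < v i" by (simp add: Inv_def v)
  with assms show False by (auto simp: Inv_def)
qed

lemma inj_on_move_inv: "inj_on (move_inv n v a b) (Inv n u)"
proof (rule inj_onI)
  fix p q assume "p \<in> Inv n u" "q \<in> Inv n u" "move_inv n v a b p = move_inv n v a b q"
  with transpose_not_mem_Inv show "p = q"
    by (cases p; cases q) (auto simp: move_inv_def inj_eq[OF inj_transpose] split: if_splits)
qed

lemma len_less: "len n u < len n v"
proof -
  have "len n u \<le> card (Inv n v - {(a, b)})"
    unfolding len_def by (rule card_inj_on_le[OF inj_on_move_inv move_inv_image]) simp
  also have "\<dots> < len n v"
    unfolding len_def by (rule card_Diff1_less) (simp_all add: top_mem_Inv)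
  finally show ?thesis .
qed

text \<open>\<open>move_inv\<close> injects \<open>Inv n u\<close> into the
  \<open>len n v - 1\<close> inversions other than \<open>(a, b)\<close>; it is onto exactly when
  the cardinalities agree.\<close>

lemma len_eq_iff_bij_betw:
  "len n v = len n u + 1 \<longleftrightarrow> bij_betw (move_inv n v a b) (Inv n u) (Inv n v - {(a, b)})"
proof -
  have card: "card (Inv n v - {(a, b)}) + 1 = len n v"
    using card_Suc_Diff1[OF _ top_mem_Inv] by (simp add: len_def)
  show ?thesis
  proof
    assume "len n v = len n u + 1"
    with card have "card (Inv n v - {(a, b)}) = card (Inv n u)" by (simp add: len_def)
    hence "move_inv n v a b ` Inv n u = Inv n v - {(a, b)}"
      by (intro card_subset_eq move_inv_image) (simp_all add: card_image[OF inj_on_move_inv])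
    thus "bij_betw (move_inv n v a b) (Inv n u) (Inv n v - {(a, b)})"
      by (simp add: bij_betw_def inj_on_move_inv)
  next
    assume "bij_betw (move_inv n v a b) (Inv n u) (Inv n v - {(a, b)})"
    from bij_betw_same_card[OF this] card show "len n v = len n u + 1" by (simp add: len_def)
  qed
qed

lemma len_eq_iff_no_between:
  "len n v = len n u + 1 \<longleftrightarrow> \<not> (\<exists>c. a < c \<and> c < b \<and> u a < u c \<and> u c < u b)"
proof
  assume "len n v = len n u + 1"
  hence onto: "move_inv n v a b ` Inv n u = Inv n v - {(a, b)}"
    using len_eq_iff_bij_betw by (simp add: bij_betw_def)
  show "\<not> (\<exists>c. a < c \<and> c < b \<and> u a < u c \<and> u c < u b)"
  proof
    assume "\<exists>c. a < c \<and> c < b \<and> u a < u c \<and> u c < u b"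
    then obtain c where c: "a < c" "c < b" "u a < u c" "u c < u b" by blast
    \<comment> \<open>The inversion \<open>(a, c)\<close> of \<open>v\<close> has no preimage: it is
      not an inversion of \<open>u\<close>, and the only pair that could move to it,
      \<open>(b, c)\<close>, has its positions in the wrong order.\<close>
    with ab have "(a, c) \<in> move_inv n v a b ` Inv n u" unfolding onto by (simp add: Inv_def)
    then obtain i j where ij: "(i, j) \<in> Inv n u" "move_inv n v a b (i, j) = (a, c)" by auto
    show False
    proof (cases "(i, j) \<in> Inv n v")
      case True
      with ij c show False by (simp add: move_inv_def Inv_def)
    next
      case False
      with ij(2) have "transpose a b i = a" "transpose a b j = c" by (auto simp: move_inv_def)
      hence "i = b" "j = c" using c by (auto simp: transpose_def split: if_splits)
      with ij(1) c show False by (simp add: Inv_def)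
    qed
  qed
next
  assume none: "\<not> (\<exists>c. a < c \<and> c < b \<and> u a < u c \<and> u c < u b)"
  have "p \<in> move_inv n v a b ` Inv n u" if p: "p \<in> Inv n v" "p \<noteq> (a, b)" for p
  proof (cases "p \<in> Inv n u")
    case True
    with p show ?thesis by (auto simp: move_inv_def intro!: image_eqI[of _ _ p])
  next
    case False
    obtain i j where ij: "p = (i, j)" by fastforce
    have *: "1 \<le> i" "i < j" "j \<le> n" "v j < v i" "u i \<le> u j"
      using p False by (auto simp: Inv_def ij)
    \<comment> \<open>The swap reverses the order of two positions other than \<open>(a, b)\<close>
      only if one is \<open>a\<close> or \<open>b\<close> and the other lies strictly between. The
      value there would then lie between \<open>u a\<close> and \<open>u b\<close>, against
      \<open>none\<close>.\<close>
    have "transpose a b i < transpose a b j \<and> 1 \<le> transpose a b i \<and> transpose a b j \<le> n"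
    proof -
      have "u i \<noteq> u j" using * inj by (auto simp: inj_eq)
      hence "u i < u j" using * by simp
      with * ab none p(2) ij show ?thesis
        by (cases "i = a"; cases "i = b"; cases "j = a"; cases "j = b")
           (force simp: transpose_def)+
    qed
    with * have "(transpose a b i, transpose a b j) \<in> Inv n u"
      by (simp add: Inv_def u_transpose)
    moreover have "(transpose a b i, transpose a b j) \<notin> Inv n v"
      using * by (auto simp: Inv_def)
    ultimately show ?thesis
      by (auto simp: move_inv_def ij intro!: image_eqI[of _ _ "(transpose a b i, transpose a b j)"])
  qed
  hence "move_inv n v a b ` Inv n u = Inv n v - {(a, b)}"
    using move_inv_image by blast
  thus "len n v = len n u + 1"
    using len_eq_iff_bij_betw inj_on_move_inv by (simp add: bij_betw_def)
qed

end

text \<open>Injectivity of \<open>u\<close> makes the transposition unique. It must raise, since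
  otherwise undoing it would be a raising swap from \<open>v\<close> to \<open>u\<close>, against
  \<open>len_less\<close>.\<close>

lemma raising_swap_of_cover:
  assumes "bruhat_cover n u v" "a < b" "v = u \<circ> transpose a b"
  shows "raising_swap n u v a b"
proof -
  have len: "len n v = len n u + 1"
    using assms(1) by (simp add: bruhat_cover_def)
  have inj: "inj u" "inj v"
    using assms(1) by (auto simp: bruhat_cover_def permutes_inj)
  obtain c d where cd: "1 \<le> c" "c < d" "d \<le> n" "v = u \<circ> transpose c d"
    using assms(1) by (auto simp: bruhat_cover_def)
  have "transpose a b = transpose c d"
    using assms(3) cd(4) inj(1) by (auto simp: fun_eq_iff inj_eq)
  with transpose_eq_imp[OF assms(2) cd(2)] cd have ab: "1 \<le> a" "b \<le> n" by auto
  have "u a < u b"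
  proof (rule ccontr)
    assume "\<not> u a < u b"
    moreover have "u a \<noteq> u b" using inj(1) assms(2) by (auto simp: inj_eq)
    ultimately have "raising_swap n v u a b"
      using ab assms(2,3) inj by unfold_locales (auto simp: comp_assoc)
    from raising_swap.len_less[OF this] len show False by simp
  qed
  with ab assms inj show ?thesis by unfold_locales auto
qed

text \<open>The cover criterion read from the upper element: the swap leaves the entries strictly
  between positions \<open>a\<close> and \<open>b\<close> alone. It produces the lower covers of
  \<open>v\<close> needed below.\<close>

lemma bruhat_cover_swapI:
  assumes "v permutes {1..n}" "1 \<le> a" "a < b" "b \<le> n" "v b < v a"
    and none: "\<not> (\<exists>c. a < c \<and> c < b \<and> v b < v c \<and> v c < v a)"
  shows "bruhat_cover n (v \<circ> transpose a b) v"
proof -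
  have perm: "v \<circ> transpose a b permutes {1..n}"
    using assms by (intro permutes_compose permutes_swap_id) auto
  have "raising_swap n (v \<circ> transpose a b) v a b"
    using assms permutes_inj[OF perm] by unfold_locales (auto simp: comp_assoc)
  from raising_swap.len_eq_iff_no_between[OF this]
  have "len n v = len n (v \<circ> transpose a b) + 1"
    using none by (auto simp: transpose_def)
  moreover have "v = (v \<circ> transpose a b) \<circ> transpose a b" by (simp add: comp_assoc)
  ultimately show ?thesis using assms(1-4) perm unfolding bruhat_cover_def by blast
qed

section \<open>Comparing \<open>GW\<close> across a cover\<close>

lemma GW_cover:
  assumes "bruhat_cover n u v" "raising_swap n u v a b"
  shows "GW n v = edge_weight u v *
    (\<Prod>p\<in>Inv n u. \<Sum>i\<in>{fst (move_inv n v a b p)..<snd (move_inv n v a b p)}. X i)"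
proof -
  interpret raising_swap n u v a b by fact
  have bij: "bij_betw (move_inv n v a b) (Inv n u) (Inv n v - {(a, b)})"
    using assms(1) by (simp add: bruhat_cover_def flip: len_eq_iff_bij_betw)
  have "GW n v = (\<Prod>p\<in>Inv n v. \<Sum>i\<in>{fst p..<snd p}. X i)"
    by (simp add: GW_def case_prod_unfold)
  \<comment> \<open>The factor at \<open>(a, b)\<close> becomes the edge weight; the others are
    reindexed by \<open>Inv n u\<close> for a factorwise comparison with
    \<open>GW n u\<close>.\<close>
  also have "\<dots> = (\<Sum>i\<in>{a..<b}. X i) * (\<Prod>p\<in>Inv n v - {(a, b)}. \<Sum>i\<in>{fst p..<snd p}. X i)"
    by (subst prod.remove[OF _ top_mem_Inv]) auto
  also have "(\<Sum>i\<in>{a..<b}. X i) = edge_weight u v"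
    unfolding v using ab(2) inj by (simp add: edge_weight_transpose)
  finally show ?thesis
    using prod.reindex_bij_betw[OF bij, of "\<lambda>p. \<Sum>i\<in>{fst p..<snd p}. X i"] by simp
qed

lemma bruhat_coverE:
  assumes "bruhat_cover n u v"
  obtains a b where "raising_swap n u v a b"
  using assms raising_swap_of_cover unfolding bruhat_cover_def by blast

lemma nonneg_coeffs_edge_weight:
  assumes "bruhat_cover n u v"
  shows "nonneg_coeffs (edge_weight u v)"
proof -
  obtain a b where "raising_swap n u v a b" using assms by (rule bruhat_coverE)
  thus ?thesis
    using edge_weight_transpose[of u a b] by (simp add: raising_swap_def nonneg_coeffs_sum_X)
qed

lemma edge_weight_mult_GW_le:
  assumes "bruhat_cover n u v"
  shows "nonneg_coeffs (GW n v - edge_weight u v * GW n u)"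
proof -
  obtain a b where rs: "raising_swap n u v a b" using assms by (rule bruhat_coverE)
  have "nonneg_coeffs
      ((\<Prod>p\<in>Inv n u. \<Sum>i\<in>{fst (move_inv n v a b p)..<snd (move_inv n v a b p)}. X i) - GW n u)"
    unfolding GW_def case_prod_unfold
    by (intro nonneg_coeffs_diff_prod nonneg_coeffs_sum_X nonneg_coeffs_sum_X_diff
          raising_swap.move_inv_mem(2)[OF rs]) auto
  with assms show ?thesis
    unfolding GW_cover[OF assms rs]
    by (intro nonneg_coeffs_diff_mult nonneg_coeffs_edge_weight nonneg_coeffs_GW) auto
qed

text \<open>If no inversion is lost, \<open>move_inv\<close> is the identity on
  \<open>Inv n u\<close>, so every factor is unchanged.\<close>

lemma GW_eq_of_Inv_subset:
  assumes "bruhat_cover n u v" "Inv n u \<subseteq> Inv n v"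
  shows "GW n v = edge_weight u v * GW n u"
proof -
  obtain a b where rs: "raising_swap n u v a b" using assms(1) by (rule bruhat_coverE)
  have "move_inv n v a b p = p" if "p \<in> Inv n u" for p
    using that assms(2) by (auto simp: move_inv_def)
  thus ?thesis
    unfolding GW_cover[OF assms(1) rs] by (simp add: GW_def case_prod_unfold)
qed

lemma GW_id: "GW n id = 1"
  by (simp only: GW_def Inv_id prod.empty)

section \<open>Greedy edges\<close>

text \<open>The condition of \<open>greedy_chain\<close> on one edge, with \<open>u'\<close> ranging
  over all lower covers of \<open>v\<close> instead of an interval; \<open>greedy_chain_iff\<close>
  reconciles the two for chains from \<open>id\<close>.\<close>

definition greedy_edge :: "nat \<Rightarrow> (nat \<Rightarrow> nat) \<Rightarrow> (nat \<Rightarrow> nat) \<Rightarrow> bool" where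
  "greedy_edge n u v \<longleftrightarrow>
     (\<forall>a b. a < b \<longrightarrow> v = u \<circ> transpose a b \<longrightarrow>
        \<not> (\<exists>u'. bruhat_cover n u' v \<and>
             ((\<exists>b'>b. v = u' \<circ> transpose a b') \<or> (\<exists>a'<a. v = u' \<circ> transpose a' b))))"

text \<open>A lost inversion exhibits a position right of \<open>b\<close> or left of
  \<open>a\<close> whose value lies between \<open>v b\<close> and \<open>v a\<close>. An extremal
  such position gives a cover reaching farther than \<open>(a, b)\<close>.\<close>

lemma greedy_edge_Inv_subset:
  assumes "bruhat_cover n u v" "greedy_edge n u v"
  shows "Inv n u \<subseteq> Inv n v"
proof (rule ccontr)
  assume "\<not> Inv n u \<subseteq> Inv n v"
  then obtain i j where moved: "(i, j) \<in> Inv n u" "(i, j) \<notin> Inv n v" by auto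
  obtain a b where rs: "raising_swap n u v a b" using assms(1) by (rule bruhat_coverE)
  interpret raising_swap n u v a b by fact
  have perm: "v permutes {1..n}" using assms(1) by (simp add: bruhat_cover_def)
  have none: "\<not> (\<exists>c. a < c \<and> c < b \<and> v b < v c \<and> v c < v a)"
  proof -
    have "len n v = len n u + 1" using assms(1) by (simp add: bruhat_cover_def)
    with len_eq_iff_no_between show ?thesis by auto
  qed
  show False
    using moved
  proof (cases rule: moved_cases)
    case 1
    \<comment> \<open>Taking the largest value in \<open>S\<close> leaves no value between
      \<open>v c\<close> and \<open>v a\<close> at positions from \<open>a\<close> to
      \<open>c\<close>, so swapping \<open>a\<close> and \<open>c\<close> is a cover.\<close>
    define S where "S = {c \<in> {b<..n}. v b < v c \<and> v c < v a}"
    have "j \<in> S" using 1 ab by (auto simp: S_def)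
    then obtain c where c: "c \<in> S" and max: "\<And>d. d \<in> S \<Longrightarrow> v d \<le> v c"
      using ex_has_greatest_nat[of "\<lambda>c. c \<in> S" j v "v a"] by (auto simp: S_def)
    have "\<not> (\<exists>d. a < d \<and> d < c \<and> v c < v d \<and> v d < v a)"
    proof
      assume "\<exists>d. a < d \<and> d < c \<and> v c < v d \<and> v d < v a"
      then obtain d where d: "a < d" "d < c" "v c < v d" "v d < v a" by blast
      have "v b < v d" using c d by (auto simp: S_def)
      \<comment> \<open>Positions strictly between \<open>a\<close> and \<open>b\<close> are
        excluded by \<open>none\<close>, and \<open>b\<close> itself by
        \<open>v b < v d\<close>.\<close>
      hence "b < d" using none d c by (metis linorder_neqE_nat order_less_irrefl)
      with d c \<open>v b < v d\<close> have "d \<in> S" by (auto simp: S_def)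
      with max d show False by fastforce
    qed
    with c ab perm have "bruhat_cover n (v \<circ> transpose a c) v"
      by (intro bruhat_cover_swapI) (auto simp: S_def)
    moreover have "v = (v \<circ> transpose a c) \<circ> transpose a c" by (simp add: comp_assoc)
    moreover have "c > b" using c by (simp add: S_def)
    ultimately show False using assms(2) ab v unfolding greedy_edge_def by blast
  next
    case 2
    \<comment> \<open>The mirror image: the smallest value left of \<open>a\<close> makes swapping
      \<open>c\<close> and \<open>b\<close> a cover.\<close>
    define S where "S = {c \<in> {1..<a}. v b < v c \<and> v c < v a}"
    have "i \<in> S" using 2 ab by (auto simp: S_def)
    then obtain c where c: "c \<in> S" and min: "\<And>d. d \<in> S \<Longrightarrow> v c \<le> v d"
      using ex_has_least_nat[of "\<lambda>c. c \<in> S" i v] by blast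
    have "\<not> (\<exists>d. c < d \<and> d < b \<and> v b < v d \<and> v d < v c)"
    proof
      assume "\<exists>d. c < d \<and> d < b \<and> v b < v d \<and> v d < v c"
      then obtain d where d: "c < d" "d < b" "v b < v d" "v d < v c" by blast
      have "v d < v a" using c d by (auto simp: S_def)
      hence "d < a" using none d c by (metis linorder_neqE_nat order_less_irrefl)
      with d c \<open>v d < v a\<close> have "d \<in> S" by (auto simp: S_def)
      with min d show False by fastforce
    qed
    with c ab perm have "bruhat_cover n (v \<circ> transpose c b) v"
      by (intro bruhat_cover_swapI) (auto simp: S_def)
    moreover have "v = (v \<circ> transpose c b) \<circ> transpose c b" by (simp add: comp_assoc)
    moreover have "c < a" using c by (simp add: S_def)
    ultimately show False using assms(2) ab v unfolding greedy_edge_def by blast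
  qed
qed

section \<open>Existence of greedy edges and induction along them\<close>

lemma eq_id_if_Inv_empty:
  assumes "w permutes {1..n}" "Inv n w = {}"
  shows "w = id"
proof -
  \<comment> \<open>Without inversions \<open>w\<close> increases on \<open>{1..n}\<close>, and a
    permutation with no value below its position is the identity.\<close>
  have "i \<le> w i" if "1 \<le> i" "i \<le> n" for i
    using that
  proof (induction i rule: nat_induct_at_least)
    case base
    thus ?case using permutes_in_image[OF assms(1), of 1] by auto
  next
    case (Suc i)
    have "\<not> w (Suc i) < w i" using assms(2) Suc by (auto simp: Inv_def)
    moreover have "w (Suc i) \<noteq> w i" using permutes_inj[OF assms(1)] by (simp add: inj_eq)
    ultimately show ?case using Suc by simp
  qed
  thus ?thesis using permutes_natset_ge[OF assms(1)] by auto
qed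

text \<open>Among the lower covers of \<open>w\<close>, one with the greatest distance
  \<open>b - a\<close> is greedy: a violation keeps one position and moves the other outward,
  increasing the distance.\<close>

lemma exists_greedy_edge:
  assumes perm: "w permutes {1..n}" and "w \<noteq> id"
  obtains u where "bruhat_cover n u w" "greedy_edge n u w"
proof -
  define P where "P = {(a, b). 1 \<le> a \<and> a < b \<and> b \<le> n \<and> bruhat_cover n (w \<circ> transpose a b) w}"
  obtain p\<^sub>0 where "p\<^sub>0 \<in> P"
  proof -
    obtain p where "p \<in> Inv n w" using eq_id_if_Inv_empty assms by blast
    \<comment> \<open>An inversion of least distance yields a lower cover: a position
      \<open>c\<close> violating the criterion would give the closer inversion
      \<open>(a, c)\<close>.\<close>
    then obtain q where "q \<in> Inv n w" and min: "\<And>r. r \<in> Inv n w \<Longrightarrow> snd q - fst q \<le> snd r - fst r"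
      using ex_has_least_nat[of "\<lambda>p. p \<in> Inv n w" p "\<lambda>p. snd p - fst p"] by blast
    then obtain a b where q: "q = (a, b)" "(a, b) \<in> Inv n w" by (metis surj_pair)
    have "\<not> (\<exists>c. a < c \<and> c < b \<and> w b < w c \<and> w c < w a)"
    proof
      assume "\<exists>c. a < c \<and> c < b \<and> w b < w c \<and> w c < w a"
      then obtain c where c: "a < c" "c < b" "w c < w a" by blast
      with q have "(a, c) \<in> Inv n w" by (simp add: Inv_def)
      from min[OF this] c q show False by simp
    qed
    with perm q have "bruhat_cover n (w \<circ> transpose a b) w"
      by (intro bruhat_cover_swapI) (auto simp: Inv_def)
    with q have "(a, b) \<in> P" by (simp add: P_def Inv_def)
    with that show ?thesis .
  qed
  moreover have "\<forall>r. r \<in> P \<longrightarrow> snd r - fst r < Suc n" by (auto simp: P_def)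
  ultimately obtain q where "q \<in> P" and max: "\<And>r. r \<in> P \<Longrightarrow> snd r - fst r \<le> snd q - fst q"
    using ex_has_greatest_nat[of "\<lambda>p. p \<in> P" p\<^sub>0 "\<lambda>p. snd p - fst p"] by blast
  then obtain a b where q: "q = (a, b)" "(a, b) \<in> P" by (metis surj_pair)
  have mem_P: "(c, d) \<in> P" if "bruhat_cover n u' w" "c < d" "w = u' \<circ> transpose c d" for u' c d
  proof -
    have "u' = w \<circ> transpose c d" using that(3) by (simp add: comp_assoc)
    moreover have "1 \<le> c" "d \<le> n"
      using raising_swap_of_cover[OF that] by (simp_all add: raising_swap_def)
    ultimately show ?thesis using that(1,2) by (simp add: P_def)
  qed
  have "greedy_edge n (w \<circ> transpose a b) w"
    unfolding greedy_edge_def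
  proof (intro allI impI notI)
    fix c d
    assume cd: "c < d" "w = w \<circ> transpose a b \<circ> transpose c d"
      and "\<exists>u'. bruhat_cover n u' w \<and>
        ((\<exists>b'>d. w = u' \<circ> transpose c b') \<or> (\<exists>a'<c. w = u' \<circ> transpose a' d))"
    then obtain u' where u': "bruhat_cover n u' w"
      "(\<exists>b'>d. w = u' \<circ> transpose c b') \<or> (\<exists>a'<c. w = u' \<circ> transpose a' d)" by blast
    have "transpose a b = transpose c d"
    proof
      fix x
      have "w (transpose c d x) = w (transpose a b x)"
        using fun_cong[OF cd(2), of "transpose c d x"] by simp
      thus "transpose a b x = transpose c d x" using permutes_inj[OF perm] by (simp add: inj_eq)
    qed
    with cd q have "c = a" "d = b" using transpose_eq_imp[of a b c d] by (auto simp: P_def)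
    have "\<exists>a' b'. (a', b') \<in> P \<and> b - a < b' - a'"
      using u'(2)
    proof
      assume "\<exists>b'>d. w = u' \<circ> transpose c b'"
      then obtain b' where "d < b'" "w = u' \<circ> transpose c b'" by blast
      with mem_P[OF u'(1), of c b'] cd(1) \<open>c = a\<close> \<open>d = b\<close> show ?thesis
        by (intro exI[of _ a] exI[of _ b']) auto
    next
      assume "\<exists>a'<c. w = u' \<circ> transpose a' d"
      then obtain a' where "a' < c" "w = u' \<circ> transpose a' d" by blast
      with mem_P[OF u'(1), of a' d] cd(1) \<open>c = a\<close> \<open>d = b\<close> show ?thesis
        by (intro exI[of _ a'] exI[of _ b]) auto
    qed
    with max q show False by fastforce
  qed
  with q that show ?thesis by (auto simp: P_def)
qed

text \<open>Each greedy edge downward lowers the length by one, and one exists until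
  \<open>id\<close> is reached.\<close>

lemma greedy_edge_induct [consumes 1, case_names id cover]:
  assumes "w permutes {1..n}" "P id"
    and "\<And>u w. bruhat_cover n u w \<Longrightarrow> greedy_edge n u w \<Longrightarrow> P u \<Longrightarrow> P w"
  shows "P w"
  using assms(1)
proof (induction "len n w" arbitrary: w rule: less_induct)
  case less
  show ?case
  proof (cases "w = id")
    case False
    with less.prems obtain u where u: "bruhat_cover n u w" "greedy_edge n u w"
      by (rule exists_greedy_edge)
    hence "P u" by (intro less.hyps) (auto simp: bruhat_cover_def)
    with u assms(3) show ?thesis by blast
  qed (simp add: assms(2))
qed

lemma bruhat_le_id:
  assumes "w permutes {1..n}"
  shows "bruhat_le n id w"
  using assms
proof (induction rule: greedy_edge_induct)
  case (cover u w)
  thus ?case unfolding bruhat_le_def by (metis rtranclp.rtrancl_into_rtrancl)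
qed (simp add: bruhat_le_def)

section \<open>Chains\<close>

lemma saturated_chain_bruhat_le:
  assumes "saturated_chain n u w C" "i < length C"
  shows "bruhat_le n (C ! i) w"
  using assms(2)
proof (induction "length C - Suc i" arbitrary: i)
  case 0
  hence "i = length C - 1" by simp
  hence "C ! i = w" using assms(1) by (auto simp: saturated_chain_def last_conv_nth)
  thus ?case by (simp add: bruhat_le_def)
next
  case (Suc k)
  hence "bruhat_cover n (C ! i) (C ! Suc i)" "bruhat_le n (C ! Suc i) w"
    using assms(1) by (auto simp: saturated_chain_def)
  thus ?case unfolding bruhat_le_def by (rule converse_rtranclp_into_rtranclp)
qed

text \<open>Every lower cover of an element of the chain lies in the interval: above
  \<open>id\<close> by \<open>bruhat_le_id\<close>, and below \<open>w\<close> along the rest of the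
  chain.\<close>

lemma greedy_chain_iff:
  "greedy_chain n id w C \<longleftrightarrow> saturated_chain n id w C \<and>
     (\<forall>i. Suc i < length C \<longrightarrow> greedy_edge n (C ! i) (C ! Suc i))"
proof -
  have "v \<in> bruhat_interval n id w"
    if "saturated_chain n id w C" "Suc i < length C" "bruhat_cover n v (C ! Suc i)" for i v
  proof -
    have "bruhat_le n v w"
      using that(3) saturated_chain_bruhat_le[OF that(1,2)]
      unfolding bruhat_le_def by (rule converse_rtranclp_into_rtranclp)
    moreover have "v permutes {1..n}" using that(3) by (simp add: bruhat_cover_def)
    ultimately show ?thesis by (simp add: bruhat_interval_def bruhat_le_id)
  qed
  thus ?thesis unfolding greedy_chain_def greedy_edge_def by blast
qed

text \<open>\<open>greedy_edge\<close> depends only on the two ends of the edge, so appending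
  \<open>w\<close> to a greedy chain ending in \<open>u\<close> keeps the earlier edges
  greedy.\<close>

lemma exists_greedy_chain:
  assumes "w permutes {1..n}"
  shows "\<exists>C. greedy_chain n id w C"
  using assms
proof (induction rule: greedy_edge_induct)
  case id
  have "greedy_chain n id id [id]"
    by (auto simp: greedy_chain_iff saturated_chain_def permutes_id)
  thus ?case ..
next
  case (cover u w)
  then obtain C where C: "greedy_chain n id u C" by blast
  have "greedy_chain n id w (C @ [w])"
    using C cover(1,2) unfolding greedy_chain_iff saturated_chain_def
    by (auto simp: nth_append last_conv_nth bruhat_cover_def less_Suc_eq)
       (metis One_nat_def diff_Suc_1)+
  thus ?case ..
qed

section \<open>Chain weights and supports\<close>

lemma chain_weight_le_GW:
  assumes "saturated_chain n id w C"
  shows "nonneg_coeffs (GW n w - chain_weight C)" "nonneg_coeffs (chain_weight C)"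
proof -
  have cover: "bruhat_cover n (C ! i) (C ! Suc i)" if "Suc i < length C" for i
    using assms that by (simp add: saturated_chain_def)
  have pos: "nonneg_coeffs (\<Prod>i<k. edge_weight (C ! i) (C ! Suc i))" if "k < length C" for k
    using that by (intro nonneg_coeffs_prod nonneg_coeffs_edge_weight[OF cover]) auto
  have C: "C \<noteq> []" "C ! 0 = id" "C ! (length C - 1) = w"
    using assms by (auto simp: saturated_chain_def hd_conv_nth last_conv_nth)
  show "nonneg_coeffs (chain_weight C)"
    using pos[of "length C - 1"] C by (simp add: chain_weight_def)
  \<comment> \<open>Induction along the chain: the product of the first \<open>k\<close> edge
    weights is bounded by \<open>GW\<close> of the element reached.\<close>
  have "nonneg_coeffs (GW n (C ! k) - (\<Prod>i<k. edge_weight (C ! i) (C ! Suc i)))"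
    if "k < length C" for k
    using that
  proof (induction k)
    case 0
    show ?case unfolding C(2) GW_id by simp
  next
    case (Suc k)
    have "nonneg_coeffs (edge_weight (C ! k) (C ! Suc k) * GW n (C ! k) -
        edge_weight (C ! k) (C ! Suc k) * (\<Prod>i<k. edge_weight (C ! i) (C ! Suc i)))"
      using Suc pos[of k] nonneg_coeffs_edge_weight[OF cover[OF Suc.prems]]
      by (intro nonneg_coeffs_diff_mult) auto
    from nonneg_coeffs_diff_trans[OF edge_weight_mult_GW_le[OF cover[OF Suc.prems]] this]
    show ?case by (simp add: mult.commute)
  qed
  from this[of "length C - 1"] show "nonneg_coeffs (GW n w - chain_weight C)"
    using C by (simp add: chain_weight_def)
qed

text \<open>The induction of \<open>chain_weight_le_GW\<close> with equality at each step, since a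
  greedy edge loses no inversion.\<close>

lemma greedy_chain_weight:
  assumes "greedy_chain n id w C"
  shows "chain_weight C = GW n w"
proof -
  have C: "C \<noteq> []" "C ! 0 = id" "C ! (length C - 1) = w"
    using assms by (auto simp: greedy_chain_def saturated_chain_def hd_conv_nth last_conv_nth)
  have "(\<Prod>i<k. edge_weight (C ! i) (C ! Suc i)) = GW n (C ! k)" if "k < length C" for k
    using that
  proof (induction k)
    case 0
    show ?case unfolding C(2) GW_id by simp
  next
    case (Suc k)
    hence "bruhat_cover n (C ! k) (C ! Suc k)" "greedy_edge n (C ! k) (C ! Suc k)"
      using assms by (auto simp: greedy_chain_iff saturated_chain_def)
    from GW_eq_of_Inv_subset[OF this(1) greedy_edge_Inv_subset[OF this]] Suc
    show ?case by (simp add: mult.commute)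
  qed
  thus ?thesis using C by (simp add: chain_weight_def)
qed

lemma supp_dual_schubert:
  assumes "w permutes {1..n}"
  shows "supp (dual_schubert n w) = supp (GW n w)"
proof -
  let ?S = "{C. saturated_chain n id w C}"
  have "supp (dual_schubert n w) = supp (\<Sum>C\<in>?S. chain_weight C)"
    by (simp add: dual_schubert_def keys_Const_mult)
  also have "\<dots> = supp (GW n w)"
  proof
    have "supp (\<Sum>C\<in>?S. chain_weight C) \<subseteq> (\<Union>C\<in>?S. supp (chain_weight C))"
      by (rule keys_sum)
    also have "\<dots> \<subseteq> supp (GW n w)"
      using keys_mono_nonneg_coeffs chain_weight_le_GW by blast
    finally show "supp (\<Sum>C\<in>?S. chain_weight C) \<subseteq> supp (GW n w)" .
  next
    obtain G where G: "greedy_chain n id w G" using exists_greedy_chain[OF assms] by blast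
    hence "G \<in> ?S" by (simp add: greedy_chain_def)
    \<comment> \<open>Splitting off a greedy chain, whose weight is \<open>GW n w\<close>, leaves a
      sum with nonnegative coefficients, so no monomial of \<open>GW n w\<close> cancels.\<close>
    hence "(\<Sum>C\<in>?S. chain_weight C) - GW n w = (\<Sum>C\<in>?S - {G}. chain_weight C)"
      by (simp add: sum.remove[OF finite_saturated_chains] greedy_chain_weight[OF G])
    moreover have "nonneg_coeffs (\<Sum>C\<in>?S - {G}. chain_weight C)"
      using chain_weight_le_GW by (intro nonneg_coeffs_sum) auto
    ultimately show "supp (GW n w) \<subseteq> supp (\<Sum>C\<in>?S. chain_weight C)"
      by (intro keys_mono_nonneg_coeffs[OF nonneg_coeffs_GW]) simp
  qed
  finally show ?thesis .
qed

theorem theorem3p16: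
  fixes n :: nat and w :: "nat \<Rightarrow> nat"
  assumes "w permutes {1..n}"
  shows "(\<forall>C. greedy_chain n id w C \<longrightarrow> dominant_chain n w C) \<and>
         supp (dual_schubert n w) = supp (GW n w) \<and>
         SCNP n w"
proof -
  have "dominant_chain n w C" if "greedy_chain n id w C" for C
    using that supp_dual_schubert[OF assms] greedy_chain_weight[OF that]
    by (simp add: dominant_chain_def greedy_chain_def)
  with exists_greedy_chain[OF assms] supp_dual_schubert[OF assms] show ?thesis
    unfolding SCNP_def by blast
qed

end
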